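(* Let $\mathcal{I}=\{0,1,2,\dots\}$. For any formally self-adjoint difference expression $\mathcal{L}$ of order $2n$ there exist functions $B_0,\dots,B_n:\mathcal{I}\to\mathbb{C}$ with $B_n(t)\neq0$ for all $t\in\mathcal{I}$, and a function $C:\mathcal{I}\to\mathbb{C}$, such that, with $$(L_ny)(t)=\sum_{j=0}^{n}B_j(t+j)y(t+j),\qquad (L_n^+y)(t)=\sum_{j=0}^{n}\overline{B_j(t)}\,y(t-j),\qquad (L_0y)(t)=C(t)y(t),$$ one has $$\mathcal{L}=L_nL_n^{+}+L_0,$$ that is, $(\mathcal{L}y)(t)=(L_n(L_n^+y))(t)+(L_0y)(t)$ for every complex sequence $y=\{y(t)\}_{t=-n}^{+\infty}$ and every $t\in\mathcal{I}$.
   Context: A formally self-adjoint difference expression of order $2n$ is an expression acting on complex sequences $y=\{y(t)\}_{t=-n}^{+\infty}$ by $$(\mathcal{L}y)(t)=\sum_{j=0}^{n}A_j(t+j)y(t+j)+\sum_{j=1}^{n}\overline{A_j(t)}\,y(t-j),\qquad t\in\mathcal{I},$$ where $A_1,\dots,A_n:\mathcal{I}\to\mathbb{C}$, $A_0:\mathcal{I}\to\mathbb{R}$, and $A_n(t)\neq0$ for all $t\in\mathcal{I}$. The expression $L_n^+$ is the formal adjoint of the forward difference expression $L_n$. *)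

theory Defs
  imports Complex_Main
begin

text \<open>
  The index set \<open>\<I> = {0, 1, 2, \<dots>}\<close> is the type \<^typ>\<open>nat\<close>, so functions on \<open>\<I>\<close> have
  type \<^typ>\<open>nat \<Rightarrow> complex\<close>. A sequence \<open>{y(t)}\<close> with \<open>t = -n, -n+1, \<dots>\<close> is a function on
  \<^typ>\<open>int\<close>; for \<open>t \<in> \<I>\<close> the expressions below never read \<open>y\<close> at an index less than \<open>-n\<close>.
  A coefficient \<open>A\<^sub>j(t)\<close> is written \<open>A j t\<close>; values \<open>A j t\<close> with \<open>j > n\<close> are irrelevant.
\<close>

type_synonym coeffs = "nat \<Rightarrow> nat \<Rightarrow> complex"

definition self_adjoint_coeffs :: "nat \<Rightarrow> coeffs \<Rightarrow> bool" where
  "self_adjoint_coeffs n A \<longleftrightarrow> (\<forall>t. A 0 t \<in> \<real>) \<and> (\<forall>t. A n t \<noteq> 0)"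

definition self_adjoint_expr :: "nat \<Rightarrow> coeffs \<Rightarrow> (int \<Rightarrow> complex) \<Rightarrow> nat \<Rightarrow> complex" where
  "self_adjoint_expr n A y t =
     (\<Sum>j=0..n. A j (t + j) * y (int t + int j)) + (\<Sum>j=1..n. cnj (A j t) * y (int t - int j))"

text \<open>The forward expression only reads its argument on \<open>\<I>\<close>, and so can be applied to the
  output of its formal adjoint, which is defined on \<open>\<I>\<close> only.\<close>

definition forward_expr :: "nat \<Rightarrow> coeffs \<Rightarrow> (nat \<Rightarrow> complex) \<Rightarrow> nat \<Rightarrow> complex" where
  "forward_expr n B u t = (\<Sum>j=0..n. B j (t + j) * u (t + j))"

definition adjoint_expr :: "nat \<Rightarrow> coeffs \<Rightarrow> (int \<Rightarrow> complex) \<Rightarrow> nat \<Rightarrow> complex" where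
  "adjoint_expr n B y t = (\<Sum>j=0..n. cnj (B j t) * y (int t - int j))"

definition order_zero_expr :: "(nat \<Rightarrow> complex) \<Rightarrow> (int \<Rightarrow> complex) \<Rightarrow> nat \<Rightarrow> complex" where
  "order_zero_expr C y t = C t * y (int t)"

end

theory Submission
  imports Defs
begin

text \<open>
  The coefficient of \<open>y (t + m)\<close> in \<open>L\<^sub>n L\<^sub>n\<^sup>+ y\<close> and the conjugate of the coefficient of
  \<open>y (t - m)\<close>, for \<open>m \<ge> 1\<close>, are the sums \<open>\<Sum>i\<le>n-m. B (i + m) (s + i) * cnj (B i (s + i))\<close> for
  \<open>s = t + m\<close> and \<open>s = t\<close>. The sum must equal \<open>A m s\<close>. Its last term is
  \<open>B n u * cnj (B (n - m) u)\<close> with \<open>u = s + n - m\<close>, and all other terms involve \<open>B\<close> only at times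
  before \<open>u\<close>. So with \<open>B n = 1\<close> the equation for \<open>(m, s)\<close> is an explicit recursion for
  \<open>B (n - m) u\<close>. The function \<open>C\<close> absorbs the discrepancy on the diagonal.
\<close>

function factor :: "nat \<Rightarrow> coeffs \<Rightarrow> coeffs" where
  "factor n A k t =
     (if n \<le> k then 1 else if t < k then 0 else
        cnj (A (n - k) (t - k) -
          (\<Sum>i<k. factor n A (i + (n - k)) (t - k + i) * cnj (factor n A i (t - k + i)))))"
  by pat_completeness auto
termination
  \<comment> \<open>Recursive calls occur only for \<open>k \<le> t\<close> and
    \<open>i < k\<close>, so their time \<open>t - k + i\<close> is below \<open>t\<close>.\<close>
  by (relation "measure (\<lambda>(n, A, k, t). t)") auto

declare factor.simps [simp del]

lemma factor_top: "factor n A n t = 1"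
  by (simp add: factor.simps)

lemma factor_equation:
  assumes "1 \<le> m" "m \<le> n"
  shows "(\<Sum>i=0..n-m. factor n A (i + m) (s + i) * cnj (factor n A i (s + i))) = A m s"
proof -
  define k where "k = n - m"
  have k: "k < n" "n - k = m" "k + m = n"
    using assms by (auto simp: k_def)
  have "{0..n-m} = insert k {..<k}"
    by (auto simp: k_def)
  \<comment> \<open>Time \<open>s + k\<close> is never below \<open>k\<close>, so the arbitrary
    default 0 is not taken here.\<close>
  moreover have "cnj (factor n A k (s + k)) =
      A m s - (\<Sum>i<k. factor n A (i + m) (s + i) * cnj (factor n A i (s + i)))"
    using k by (subst factor.simps) simp
  ultimately show ?thesis
    using k by (simp add: factor_top)
qed

lemma sum_square_by_diagonals:
  fixes f :: "nat \<Rightarrow> nat \<Rightarrow> 'a::comm_monoid_add"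
  shows "(\<Sum>j=0..n. \<Sum>k=0..n. f j k) =
    (\<Sum>j=0..n. f j j) + (\<Sum>m=1..n. \<Sum>i=0..n-m. f (i + m) i) + (\<Sum>m=1..n. \<Sum>i=0..n-m. f i (i + m))"
proof -
  have lower: "(\<Sum>j=0..n. \<Sum>k=0..<j. g j k) = (\<Sum>m=1..n. \<Sum>i=0..n-m. g (i + m) i)"
    for g :: "nat \<Rightarrow> nat \<Rightarrow> 'a"
    unfolding sum.Sigma[OF finite_atLeastAtMost ballI[OF finite_atLeastLessThan]]
      sum.Sigma[OF finite_atLeastAtMost ballI[OF finite_atLeastAtMost]]
    by (rule sum.reindex_bij_witness[where i = "\<lambda>(m, i). (i + m, i)" and j = "\<lambda>(j, k). (j - k, k)"])
      auto
  have split: "(\<Sum>k=0..n. f j k) = f j j + (\<Sum>k=0..<j. f j k) + (\<Sum>k=Suc j..n. f j k)"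
    if "j \<in> {0..n}" for j
  proof -
    have "{0..n} = insert j ({0..<j} \<union> {Suc j..n})"
      using that by auto
    moreover have "sum (f j) ({0..<j} \<union> {Suc j..n}) = sum (f j) {0..<j} + sum (f j) {Suc j..n}"
      by (rule sum.union_disjoint) auto
    ultimately show ?thesis
      by (simp add: add.assoc)
  qed
  \<comment> \<open>Transposing moves the part above the diagonal below it, where
    \<open>lower\<close> applies.\<close>
  have "(\<Sum>j=0..n. \<Sum>k=Suc j..n. f j k) = (\<Sum>k=0..n. \<Sum>j=0..<k. f j k)"
    unfolding sum.Sigma[OF finite_atLeastAtMost ballI[OF finite_atLeastLessThan]]
      sum.Sigma[OF finite_atLeastAtMost ballI[OF finite_atLeastAtMost]]
    by (rule sum.reindex_bij_witness[where i = prod.swap and j = prod.swap]) auto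
  then have "(\<Sum>j=0..n. \<Sum>k=Suc j..n. f j k) = (\<Sum>m=1..n. \<Sum>i=0..n-m. f i (i + m))"
    using lower[of "\<lambda>j k. f k j"] by simp
  then show ?thesis
    using lower[of f] by (simp add: split sum.distrib)
qed

text \<open>The \<open>(j, k)\<close> term of the composition carries \<open>y (t + j - k)\<close>,
  so each diagonal \<open>j - k = m\<close> or \<open>k - j = m\<close> collects one value of
  \<open>y\<close>.\<close>

lemma forward_adjoint_expand:
  "forward_expr n B (adjoint_expr n B y) t =
     (\<Sum>j=0..n. B j (t + j) * cnj (B j (t + j))) * y (int t) +
     (\<Sum>m=1..n. (\<Sum>i=0..n-m. B (i + m) (t + m + i) * cnj (B i (t + m + i))) * y (int t + int m)) +
     (\<Sum>m=1..n. cnj (\<Sum>i=0..n-m. B (i + m) (t + i) * cnj (B i (t + i))) * y (int t - int m))"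
proof -
  have "forward_expr n B (adjoint_expr n B y) t =
      (\<Sum>j=0..n. \<Sum>k=0..n. B j (t + j) * cnj (B k (t + j)) * y (int (t + j) - int k))"
    by (simp add: forward_expr_def adjoint_expr_def sum_distrib_left mult.assoc)
  then show ?thesis
    unfolding sum_square_by_diagonals
    by (simp add: sum_distrib_left sum_distrib_right algebra_simps)
qed

theorem theorem3p5:
  fixes n :: nat and A :: "nat \<Rightarrow> nat \<Rightarrow> complex"
  assumes "self_adjoint_coeffs n A"
  shows "\<exists>(B :: nat \<Rightarrow> nat \<Rightarrow> complex) (C :: nat \<Rightarrow> complex).
           (\<forall>t. B n t \<noteq> 0) \<and>
           (\<forall>(y :: int \<Rightarrow> complex) (t :: nat).
              self_adjoint_expr n A y t =
                forward_expr n B (adjoint_expr n B y) t + order_zero_expr C y t)"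
proof -
  let ?B = "factor n A"
  let ?C = "\<lambda>t. A 0 t - (\<Sum>j=0..n. ?B j (t + j) * cnj (?B j (t + j)))"
  have "self_adjoint_expr n A y t =
      forward_expr n ?B (adjoint_expr n ?B y) t + order_zero_expr ?C y t" for y t
  proof -
    have "forward_expr n ?B (adjoint_expr n ?B y) t =
        (\<Sum>j=0..n. ?B j (t + j) * cnj (?B j (t + j))) * y (int t) +
        (\<Sum>m=1..n. A m (t + m) * y (int t + int m)) + (\<Sum>m=1..n. cnj (A m t) * y (int t - int m))"
      unfolding forward_adjoint_expand
      by (intro arg_cong2[where f = "(+)"] sum.cong refl)
        \<comment> \<open>\<open>cnj\<close> must stay outside the sum for
          \<open>factor_equation\<close> to match.\<close>
        (simp_all add: factor_equation del: cnj_sum complex_cnj_mult)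
    then show ?thesis
      by (simp add: self_adjoint_expr_def order_zero_expr_def sum.atLeast_Suc_atMost algebra_simps)
  qed
  moreover have "\<forall>t. ?B n t \<noteq> 0"
    by (simp add: factor_top)
  ultimately show ?thesis
    by blast
qed

end
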